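(* Let $K$ be a nonempty set and let $\mathbb{Y}$ be a proper closed subspace of $\ell_\infty(K)$. Then the following are equivalent: (i) $\mathbb{Y}$ is strongly anti-coproximinal in $\ell_\infty(K)$. (ii) $\mathbb{Y}$ is anti-coproximinal in $\ell_\infty(K)$. (iii) For any $k\in K$, there exists $f\in\mathbb{Y}$ such that $|f(k)|>\lim_{n\to\infty}|f(k_n)|$ for every sequence $\{k_n\}\subset K$ with $k_n\neq k$ for all but finitely many $n\in\mathbb{N}$ and for which the limit $\lim_{n\to\infty}|f(k_n)|$ exists.
   Context: $\ell_\infty(K)$ is the Banach space of all bounded scalar-valued functions on $K$ (scalars $\mathbb{R}$ or $\mathbb{C}$) with the supremum norm. Let $\mathbb{X}$ be a Banach space and $\mathbb{Y}$ a subspace. For $x\in\mathbb{X}$, $y_0\in\mathbb{Y}$ is a best coapproximation to $x$ out of $\mathbb{Y}$ if $\|y_0-y\|\le\|x-y\|$ for all $y\in\mathbb{Y}$. $\mathbb{Y}$ is anti-coproximinal in $\mathbb{X}$ if for every $x\in\mathbb{X}\setminus\mathbb{Y}$ there is no best coapproximation to $x$ out of $\mathbb{Y}$. For $\epsilon\in[0,1)$ and $x,y\in\mathbb{X}$, write $x\perp_B^{\epsilon} y$ if $\|x+\lambda y\|\ge\|x\|-\epsilon\|\lambda y\|$ for every scalar $\lambda$; $y_0\in\mathbb{Y}$ is an $\epsilon$-best coapproximation to $x$ out of $\mathbb{Y}$ if $y\perp_B^{\epsilon}(x-y_0)$ for all $y\in\mathbb{Y}$. $\mathbb{Y}$ is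 strongly anti-coproximinal in $\mathbb{X}$ if for every $x\in\mathbb{X}\setminus\mathbb{Y}$ and every $\epsilon\in[0,1)$ there is no $\epsilon$-best coapproximation to $x$ out of $\mathbb{Y}$.
   Formalization: The equivalence with (iii) is stated only when K has at least two points; if K is a single point and Y = {0}, (iii) holds vacuously while (i) and (ii) fail. The equivalence of (i) and (ii) is stated for every nonempty K. *)

theory Defs
  imports "HOL-Analysis.Analysis" "HOL-Probability.Discrete_Topology"
begin

text \<open>
  The library's spaces of bounded functions and its orthogonality notions only know real scalars,
  so the scalar field is a type \<open>'f\<close> of sort \<open>{real_normed_field, banach}\<close> and the notions that
  mention scalars take the scalar multiplication as a parameter. In that sort the norm is
  multiplicative, so by the Gelfand-Mazur theorem its members are, up to isometric isomorphism,
  exactly the real and the complex numbers.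
\<close>

definition best_coapprox :: "'a::real_normed_vector set \<Rightarrow> 'a \<Rightarrow> 'a \<Rightarrow> bool" where
  "best_coapprox Y x y0 \<longleftrightarrow> y0 \<in> Y \<and> (\<forall>y\<in>Y. norm (y0 - y) \<le> norm (x - y))"

definition anti_coproximinal :: "'a::real_normed_vector set \<Rightarrow> bool" where
  "anti_coproximinal Y \<longleftrightarrow> (\<forall>x. x \<notin> Y \<longrightarrow> \<not> (\<exists>y0. best_coapprox Y x y0))"

definition eps_BJ_orthogonal ::
    "('f \<Rightarrow> 'a \<Rightarrow> 'a::real_normed_vector) \<Rightarrow> real \<Rightarrow> 'a \<Rightarrow> 'a \<Rightarrow> bool" where
  "eps_BJ_orthogonal smul \<epsilon> x y \<longleftrightarrow>
     (\<forall>c. norm (x + smul c y) \<ge> norm x - \<epsilon> * norm (smul c y))"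

definition eps_best_coapprox ::
    "('f \<Rightarrow> 'a \<Rightarrow> 'a::real_normed_vector) \<Rightarrow> real \<Rightarrow> 'a set \<Rightarrow> 'a \<Rightarrow> 'a \<Rightarrow> bool" where
  "eps_best_coapprox smul \<epsilon> Y x y0 \<longleftrightarrow>
     y0 \<in> Y \<and> (\<forall>y\<in>Y. eps_BJ_orthogonal smul \<epsilon> y (x - y0))"

definition strongly_anti_coproximinal ::
    "('f \<Rightarrow> 'a \<Rightarrow> 'a::real_normed_vector) \<Rightarrow> 'a set \<Rightarrow> bool" where
  "strongly_anti_coproximinal smul Y \<longleftrightarrow>
     (\<forall>x. x \<notin> Y \<longrightarrow> (\<forall>\<epsilon>. 0 \<le> \<epsilon> \<and> \<epsilon> < 1 \<longrightarrow> \<not> (\<exists>y0. eps_best_coapprox smul \<epsilon> Y x y0)))"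

text \<open>
  The nonempty set \<open>K\<close> is an arbitrary type \<open>'k\<close>, given the discrete topology, so that continuity
  is no restriction and the bounded continuous functions are all bounded functions
  (lemma \<open>range_apply_linf\<close>).
\<close>

type_synonym ('k, 'f) linf = "'k discrete \<Rightarrow>\<^sub>C 'f"

lemma bounded_in_bcontfun:
  fixes f :: "'k discrete \<Rightarrow> 'f::metric_space"
  assumes "bounded (range f)"
  shows "f \<in> bcontfun"
  using assms by (auto simp: bcontfun_def continuous_on_open_invariant open_discrete)

lemma range_apply_linf:
  "range (apply_bcontfun :: ('k, 'f::metric_space) linf \<Rightarrow> _) = {f. bounded (range f)}"
  by (auto elim!: bcontfunE dest!: bounded_in_bcontfun)

lemma norm_linf:
  fixes f :: "('k, 'f::real_normed_vector) linf"
  shows "norm f = (SUP k. norm (apply_bcontfun f k))"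
  by (simp add: norm_bcontfun_def dist_bcontfun.rep_eq)

definition scale_linf :: "'f::real_normed_field \<Rightarrow> ('k, 'f) linf \<Rightarrow> ('k, 'f) linf" where
  "scale_linf c f = Bcontfun (\<lambda>k. c * apply_bcontfun f k)"

lemma apply_scale_linf [simp]:
  "apply_bcontfun (scale_linf c f) k = c * apply_bcontfun f k"
proof -
  have "bounded (range (\<lambda>k. c * apply_bcontfun f k))"
    by (rule boundedI[where B = "norm c * norm f"])
       (auto simp: norm_mult intro!: mult_left_mono norm_bounded)
  then show ?thesis
    unfolding scale_linf_def by (simp add: Bcontfun_inverse bounded_in_bcontfun)
qed

global_interpretation linf: vector_space "scale_linf :: 'f::real_normed_field \<Rightarrow> ('k, 'f) linf \<Rightarrow> _"
  by standard (auto intro!: bcontfun_eqI simp: algebra_simps)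

end

theory Submission
  imports Defs
begin

text \<open>
  Both anti-coproximinality conditions amount to this: every point \<open>k\<close> is a peak point of \<open>Y\<close>,
  that is, some \<open>f \<in> Y\<close> satisfies \<open>\<bar>f k\<bar> > sup {\<bar>f j\<bar> | j \<noteq> k}\<close>, where the supremum of the empty
  set is \<open>0\<close>. The condition on sequences says the same when there are at least two points; over
  a single point no sequence qualifies, and it holds for every \<open>Y\<close>.

  If \<open>f\<close> peaks at \<open>k\<close> and \<open>h\<close> is a function with \<open>\<bar>h k\<bar> > \<epsilon> \<parallel>h\<parallel>\<close>, then subtracting from \<open>f\<close> a small
  multiple of \<open>h\<close> that points in the direction of \<open>f\<close> at \<open>k\<close> lowers the norm at a rate greater
  than \<open>\<epsilon> \<parallel>h\<parallel>\<close>, because near \<open>f\<close> only the value at \<open>k\<close> decides the norm. When \<open>\<epsilon> < 1\<close>, every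
  \<open>h \<noteq> 0\<close> has such a point \<open>k\<close>; with \<open>h = x - y0\<close> this shows that no \<open>x\<close> outside \<open>Y\<close> has an
  \<open>\<epsilon>\<close>-best coapproximation (\<open>peak_not_eps_BJ_orthogonal\<close>,
  \<open>strongly_anti_coproximinal_if_peak\<close>).

  If no member of \<open>Y\<close> peaks at \<open>k\<close>, then changing the value at \<open>k\<close> never makes the norm of a
  member of \<open>Y\<close> smaller. Hence the indicator function of \<open>k\<close>, which does peak at \<open>k\<close> and so lies
  outside \<open>Y\<close>, has the best coapproximation \<open>0\<close> (\<open>peak_if_anti_coproximinal\<close>).

  A best coapproximation is a \<open>0\<close>-best coapproximation, since \<open>Y\<close> is a subspace
  (\<open>best_coapprox_imp_eps_best_coapprox_0\<close>), so the strong condition implies the other one.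
  Finally, the supremum over \<open>j \<noteq> k\<close> is the limit along a maximizing sequence whenever there is
  such a \<open>j\<close> (\<open>peaks_at_iff_lim_less\<close>).
\<close>

section \<open>Norm and orthogonality in the space of bounded functions\<close>

lemma norm_apply_le_norm_linf:
  fixes f :: "('k, 'f::real_normed_vector) linf"
  shows "norm (apply_bcontfun f k) \<le> norm f"
  by (rule norm_bounded)

lemma norm_linf_le:
  fixes f :: "('k, 'f::real_normed_vector) linf"
  assumes "\<And>k. norm (apply_bcontfun f k) \<le> b"
  shows "norm f \<le> b"
  unfolding norm_linf by (rule cSUP_least) (use assms in auto)

lemma norm_scale_linf:
  fixes f :: "('k, 'f::real_normed_field) linf"
  shows "norm (scale_linf c f) = norm c * norm f"
proof (rule antisym)
  show le: "norm (scale_linf c f) \<le> norm c * norm f" for c and f :: "('k, 'f) linf"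
    by (rule norm_linf_le) (simp add: norm_mult mult_left_mono norm_apply_le_norm_linf)
  show "norm c * norm f \<le> norm (scale_linf c f)"
  proof (cases "c = 0")
    case False
    \<comment> \<open>The reverse inequality is the one above for the scalar \<open>inverse c\<close>.\<close>
    have "norm f = norm (scale_linf (inverse c) (scale_linf c f))"
      using False by simp
    also have "\<dots> \<le> norm (inverse c) * norm (scale_linf c f)"
      by (rule le)
    also have "\<dots> = norm (scale_linf c f) / norm c"
      using False by (simp add: nonzero_norm_inverse divide_inverse_commute)
    finally show ?thesis
      using False by (simp add: pos_le_divide_eq mult.commute)
  qed simp
qed

lemma best_coapprox_imp_eps_best_coapprox_0:
  fixes Y :: "('k, 'f::real_normed_field) linf set"
  assumes Y: "linf.subspace Y" and best: "best_coapprox Y x y0"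
  shows "eps_best_coapprox scale_linf 0 Y x y0"
  unfolding eps_best_coapprox_def eps_BJ_orthogonal_def
proof (intro conjI ballI allI)
  show y0: "y0 \<in> Y"
    using best by (simp add: best_coapprox_def)
  fix y c assume y: "y \<in> Y"
  show "norm y - 0 * norm (scale_linf c (x - y0)) \<le> norm (y + scale_linf c (x - y0))"
  proof (cases "c = 0")
    case False
    define z where "z = scale_linf (inverse c) y"
    have "y0 - z \<in> Y"
      unfolding z_def using Y y0 y by (intro linf.subspace_diff linf.subspace_scale)
    then have "norm (y0 - (y0 - z)) \<le> norm (x - (y0 - z))"
      using best unfolding best_coapprox_def by blast
    then have "norm z \<le> norm (z + (x - y0))"
      by (simp add: algebra_simps)
    then have "norm (scale_linf c z) \<le> norm (scale_linf c (z + (x - y0)))"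
      by (simp add: norm_scale_linf mult_left_mono)
    then show ?thesis
      using False by (simp add: z_def linf.scale_right_distrib)
  qed simp
qed

lemma anti_coproximinal_if_strongly:
  fixes Y :: "('k, 'f::real_normed_field) linf set"
  assumes "linf.subspace Y" and "strongly_anti_coproximinal scale_linf Y"
  shows "anti_coproximinal Y"
  using assms best_coapprox_imp_eps_best_coapprox_0
  unfolding anti_coproximinal_def strongly_anti_coproximinal_def
  by (metis order_refl zero_less_one)

section \<open>Peak points\<close>

text \<open>
  The function \<open>f\<close> peaks at \<open>k\<close> if its modulus at \<open>k\<close> exceeds its moduli at the other points by a
  uniform margin. The bound \<open>r\<close> takes the place of the supremum over the other points;
  \<open>0 \<le> r\<close> matters only when there are no other points, and then peaking at the only point means
  not vanishing there.
\<close>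

definition peaks_at :: "('k, 'f::real_normed_vector) linf \<Rightarrow> 'k discrete \<Rightarrow> bool" where
  "peaks_at f k \<longleftrightarrow>
     (\<exists>r. 0 \<le> r \<and> r < norm (apply_bcontfun f k) \<and> (\<forall>j. j \<noteq> k \<longrightarrow> norm (apply_bcontfun f j) \<le> r))"

lemma peak_not_eps_BJ_orthogonal:
  fixes f h :: "('k, 'f::real_normed_field) linf"
  assumes "peaks_at f k" and \<epsilon>: "0 \<le> \<epsilon>" and hk: "\<epsilon> * norm h < norm (apply_bcontfun h k)"
  shows "\<not> eps_BJ_orthogonal scale_linf \<epsilon> f h"
proof
  assume orth: "eps_BJ_orthogonal scale_linf \<epsilon> f h"
  obtain r where r: "0 \<le> r" "r < norm (apply_bcontfun f k)"
    and others: "\<And>j. j \<noteq> k \<Longrightarrow> norm (apply_bcontfun f j) \<le> r"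
    using assms(1) unfolding peaks_at_def by blast
  define A where "A = norm (apply_bcontfun f k)"
  define a where "a = norm (apply_bcontfun h k)"
  define H where "H = norm h"
  have A: "A > 0" unfolding A_def using r by (rule le_less_trans)
  have a: "a > 0"
    using hk \<epsilon> by (smt (verit) a_def mult_nonneg_nonneg norm_ge_zero)
  have H: "H \<ge> 0" by (simp add: H_def)
  \<comment> \<open>The largest \<open>t\<close> for which the bound \<open>r + (t * A / a) * H\<close> at the points other than \<open>k\<close> does
    not exceed the modulus \<open>(1 - t) * A\<close> at \<open>k\<close>.\<close>
  define t where "t = (A - r) / (A * (1 + H / a))"
  define c where "c = - (of_real t * apply_bcontfun f k / apply_bcontfun h k)"
  have den: "1 \<le> 1 + H / a" using a H by simp
  have tA: "t * A * (1 + H / a) = A - r"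
    using A den by (simp add: t_def)
  have t: "t > 0"
    using A r den unfolding t_def A_def[symmetric] by (intro divide_pos_pos mult_pos_pos) auto
  have "t * A \<le> t * A * (1 + H / a)"
    using mult_left_mono[OF den, of "t * A"] t A by simp
  then have t1: "t * A \<le> A" using tA r by linarith
  have norm_c: "norm c = t * A / a"
    using t by (simp add: c_def A_def a_def norm_mult norm_divide)
  have value_k: "norm (apply_bcontfun (f + scale_linf c h) k) = A - t * A"
  proof -
    have "apply_bcontfun (f + scale_linf c h) k = of_real (1 - t) * apply_bcontfun f k"
      using a by (simp add: c_def a_def algebra_simps)
    then have "norm (apply_bcontfun (f + scale_linf c h) k) = \<bar>1 - t\<bar> * A"
      by (simp only: norm_mult norm_of_real A_def)
    moreover have "t \<le> 1" using t1 A by simp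
    ultimately show ?thesis by (simp add: algebra_simps)
  qed
  have "norm (f + scale_linf c h) \<le> A - t * A"
  proof (rule norm_linf_le)
    fix j
    show "norm (apply_bcontfun (f + scale_linf c h) j) \<le> A - t * A"
    proof (cases "j = k")
      case False
      have "norm (apply_bcontfun (f + scale_linf c h) j)
          \<le> norm (apply_bcontfun f j) + norm c * norm (apply_bcontfun h j)"
        by (simp add: norm_triangle_le norm_mult)
      also have "\<dots> \<le> r + norm c * H"
        using others[OF False] norm_apply_le_norm_linf[of h j] unfolding H_def
        by (intro add_mono mult_left_mono) auto
      also have "\<dots> = A - t * A"
        using tA by (simp add: norm_c algebra_simps)
      finally show ?thesis .
    qed (simp only: value_k)
  qed
  moreover have "A \<le> norm f"
    unfolding A_def by (rule norm_apply_le_norm_linf)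
  moreover have "norm f - \<epsilon> * norm (scale_linf c h) \<le> norm (f + scale_linf c h)"
    using orth unfolding eps_BJ_orthogonal_def by blast
  ultimately have "t * A \<le> \<epsilon> * (t * A / a * H)"
    by (simp add: norm_scale_linf norm_c H_def)
  also have "\<dots> = t * A * (\<epsilon> * H / a)" by simp
  also have "\<dots> < t * A * 1"
    using t A a hk by (intro mult_strict_left_mono) (auto simp: a_def H_def)
  finally show False by simp
qed

lemma strongly_anti_coproximinal_if_peak:
  fixes Y :: "('k, 'f::real_normed_field) linf set"
  assumes peak: "\<And>k. \<exists>f\<in>Y. peaks_at f k"
  shows "strongly_anti_coproximinal scale_linf Y"
  unfolding strongly_anti_coproximinal_def
proof (intro allI impI notI)
  fix x \<epsilon> assume x: "x \<notin> Y" and \<epsilon>: "0 \<le> \<epsilon> \<and> \<epsilon> < (1::real)"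
    and "\<exists>y0. eps_best_coapprox scale_linf \<epsilon> Y x y0"
  then obtain y0 where y0: "y0 \<in> Y"
    and orth: "\<And>y. y \<in> Y \<Longrightarrow> eps_BJ_orthogonal scale_linf \<epsilon> y (x - y0)"
    unfolding eps_best_coapprox_def by blast
  define h where "h = x - y0"
  have "h \<noteq> 0" using x y0 by (auto simp: h_def)
  then have "\<epsilon> * norm h < norm h" using \<epsilon> by simp
  then obtain k where k: "\<epsilon> * norm h < norm (apply_bcontfun h k)"
    using norm_linf_le[of h "\<epsilon> * norm h"] by (meson not_le)
  obtain f where "f \<in> Y" "peaks_at f k" using peak by blast
  with peak_not_eps_BJ_orthogonal[OF _ _ k] orth \<epsilon> show False
    unfolding h_def by blast
qed

lemma peak_if_anti_coproximinal:
  fixes Y :: "('k, 'f::real_normed_field) linf set"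
  assumes Y: "linf.subspace Y" and anti: "anti_coproximinal Y"
  shows "\<exists>f\<in>Y. peaks_at f k"
proof (rule ccontr)
  assume none: "\<not> (\<exists>f\<in>Y. peaks_at f k)"
  define e :: "('k, 'f) linf" where "e = Bcontfun (\<lambda>j. of_bool (j = k))"
  have "bounded (range (\<lambda>j. of_bool (j = k) :: 'f))"
    by (rule boundedI[where B = 1]) auto
  then have e: "apply_bcontfun e j = of_bool (j = k)" for j
    unfolding e_def by (simp add: Bcontfun_inverse bounded_in_bcontfun)
  have "peaks_at e k"
    unfolding peaks_at_def by (rule exI[of _ 0]) (simp add: e)
  then have "e \<notin> Y" using none by blast
  moreover have "best_coapprox Y e 0"
    unfolding best_coapprox_def
  proof (intro conjI ballI)
    show "0 \<in> Y" using Y by (rule linf.subspace_0)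
    fix y assume y: "y \<in> Y"
    have others: "norm (apply_bcontfun y j) \<le> norm (e - y)" if "j \<noteq> k" for j
      using norm_apply_le_norm_linf[of "e - y" j] that by (simp add: e)
    moreover have "norm (apply_bcontfun y k) \<le> norm (e - y)"
      using none y others unfolding peaks_at_def by (meson norm_ge_zero not_le)
    ultimately have "norm y \<le> norm (e - y)"
      by (intro norm_linf_le) metis
    then show "norm (0 - y) \<le> norm (e - y)" by simp
  qed
  ultimately show False
    using anti unfolding anti_coproximinal_def by blast
qed

section \<open>Peaking in terms of sequences\<close>

lemma peaks_at_iff_lim_less:
  fixes f :: "('k, 'f::real_normed_vector) linf"
  assumes other: "j0 \<noteq> k"
  shows "peaks_at f k \<longleftrightarrow>
    (\<forall>s :: nat \<Rightarrow> 'k discrete.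
       (\<forall>\<^sub>F n in sequentially. s n \<noteq> k) \<and> convergent (\<lambda>n. norm (apply_bcontfun f (s n))) \<longrightarrow>
       norm (apply_bcontfun f k) > lim (\<lambda>n. norm (apply_bcontfun f (s n))))"
    (is "_ \<longleftrightarrow> ?seq")
proof
  assume "peaks_at f k"
  then obtain r where r: "r < norm (apply_bcontfun f k)"
    and others: "\<And>j. j \<noteq> k \<Longrightarrow> norm (apply_bcontfun f j) \<le> r"
    unfolding peaks_at_def by blast
  show ?seq
  proof (intro allI impI, elim conjE)
    fix s assume ev: "\<forall>\<^sub>F n in sequentially. s n \<noteq> k"
      and conv: "convergent (\<lambda>n. norm (apply_bcontfun f (s n)))"
    have "lim (\<lambda>n. norm (apply_bcontfun f (s n))) \<le> r"
    proof (rule tendsto_upperbound)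
      show "(\<lambda>n. norm (apply_bcontfun f (s n))) \<longlonglongrightarrow> lim (\<lambda>n. norm (apply_bcontfun f (s n)))"
        using conv by (simp add: convergent_LIMSEQ_iff)
      show "\<forall>\<^sub>F n in sequentially. norm (apply_bcontfun f (s n)) \<le> r"
        using ev by eventually_elim (rule others)
    qed simp
    with r show "lim (\<lambda>n. norm (apply_bcontfun f (s n))) < norm (apply_bcontfun f k)"
      by simp
  qed
next
  assume seq: ?seq
  define S where "S = (SUP j\<in>-{k}. norm (apply_bcontfun f j))"
  have bdd: "bdd_above ((\<lambda>j. norm (apply_bcontfun f j)) ` (-{k}))"
    by (rule bdd_aboveI2) (rule norm_apply_le_norm_linf)
  have le_S: "norm (apply_bcontfun f j) \<le> S" if "j \<noteq> k" for j
    unfolding S_def using that by (intro cSUP_upper bdd) auto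
  have "\<exists>j. j \<noteq> k \<and> S - 1 / real (Suc n) < norm (apply_bcontfun f j)" for n
  proof -
    have "S - 1 / real (Suc n) < S" by simp
    then show ?thesis
      using less_cSUP_iff[OF _ bdd, of "S - 1 / real (Suc n)"] other
      by (auto simp flip: S_def)
  qed
  then obtain s where s: "\<And>n. s n \<noteq> k" "\<And>n. S - 1 / real (Suc n) < norm (apply_bcontfun f (s n))"
    by metis
  have "(\<lambda>n. norm (apply_bcontfun f (s n))) \<longlonglongrightarrow> S"
  proof (rule tendsto_sandwich)
    show "(\<lambda>n. S - 1 / real (Suc n)) \<longlonglongrightarrow> S"
      using tendsto_diff[OF tendsto_const LIMSEQ_inverse_real_of_nat, of S]
      by (simp add: inverse_eq_divide)
    show "\<forall>\<^sub>F n in sequentially. S - 1 / real (Suc n) \<le> norm (apply_bcontfun f (s n))"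
      using s(2) by (intro always_eventually allI less_imp_le)
    show "\<forall>\<^sub>F n in sequentially. norm (apply_bcontfun f (s n)) \<le> S"
      by (intro always_eventually allI le_S s(1))
  qed (rule tendsto_const)
  then have "convergent (\<lambda>n. norm (apply_bcontfun f (s n)))"
    and lim: "lim (\<lambda>n. norm (apply_bcontfun f (s n))) = S"
    by (rule convergentI, rule limI)
  then have "lim (\<lambda>n. norm (apply_bcontfun f (s n))) < norm (apply_bcontfun f k)"
    using seq[rule_format, of s] s(1) by simp
  then have "S < norm (apply_bcontfun f k)"
    by (simp only: lim)
  moreover have "0 \<le> S"
    using le_S[OF other] norm_ge_zero order_trans by blast
  ultimately show "peaks_at f k"
    unfolding peaks_at_def using le_S by blast
qed

theorem theorem3p17:
  fixes Y :: "('k, 'f::{real_normed_field,banach}) linf set"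
  assumes "linf.subspace Y" and "closed Y" and "Y \<noteq> UNIV"
  shows "(strongly_anti_coproximinal scale_linf Y \<longleftrightarrow> anti_coproximinal Y) \<and>
    ((\<exists>k k' :: 'k. k \<noteq> k') \<longrightarrow>
      (anti_coproximinal Y \<longleftrightarrow>
        (\<forall>k :: 'k discrete. \<exists>f\<in>Y. \<forall>s :: nat \<Rightarrow> 'k discrete.
           (\<forall>\<^sub>F n in sequentially. s n \<noteq> k) \<and>
           convergent (\<lambda>n. norm (apply_bcontfun f (s n))) \<longrightarrow>
           norm (apply_bcontfun f k) > lim (\<lambda>n. norm (apply_bcontfun f (s n))))))"
proof (intro conjI impI)
  have anti: "anti_coproximinal Y \<longleftrightarrow> (\<forall>k. \<exists>f\<in>Y. peaks_at f k)"
    using assms(1) peak_if_anti_coproximinal anti_coproximinal_if_strongly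
      strongly_anti_coproximinal_if_peak by metis
  then show "strongly_anti_coproximinal scale_linf Y \<longleftrightarrow> anti_coproximinal Y"
    using assms(1) anti_coproximinal_if_strongly strongly_anti_coproximinal_if_peak by metis
  assume "\<exists>k k' :: 'k. k \<noteq> k'"
  then obtain a b :: 'k where "discrete a \<noteq> discrete b"
    by (metis discrete_inverse UNIV_I)
  then have "\<exists>j. j \<noteq> k" for k :: "'k discrete"
    by metis
  then obtain other :: "'k discrete \<Rightarrow> 'k discrete" where "\<And>k. other k \<noteq> k"
    by metis
  then show "anti_coproximinal Y \<longleftrightarrow>
        (\<forall>k :: 'k discrete. \<exists>f\<in>Y. \<forall>s :: nat \<Rightarrow> 'k discrete.
           (\<forall>\<^sub>F n in sequentially. s n \<noteq> k) \<and>
           convergent (\<lambda>n. norm (apply_bcontfun f (s n))) \<longrightarrow>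
           norm (apply_bcontfun f k) > lim (\<lambda>n. norm (apply_bcontfun f (s n))))"
    unfolding anti by (intro all_cong1 bex_cong refl peaks_at_iff_lim_less)
qed

end
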